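(* Let $s$ and $t$ be positive integers with $s<t$ and $s\not\equiv t\pmod 2$. Let $\mathcal{M}'=(E_s,\mathcal{L}')=(E_s,\mathcal{T}')$ and $\mathcal{M}''=(E_t,\mathcal{L}'')=(E_t,\mathcal{T}'')$ be simple oriented matroids on the ground sets $E_s=\{1,\ldots,s\}$ and $E_t=\{1,\ldots,t\}$, with sets of covectors $\mathcal{L}'$, $\mathcal{L}''$ and sets of topes $\mathcal{T}'\subseteq\{1,-1\}^{E_s}$, $\mathcal{T}''\subseteq\{1,-1\}^{E_t}$, respectively. Let $\boldsymbol{R}'$ be a symmetric $2s$-cycle in the tope graph of $\mathcal{M}'$, and let $\boldsymbol{R}''$ be a symmetric $2t$-cycle in the tope graph of $\mathcal{M}''$, with vertex sets $\mathrm{V}(\boldsymbol{R}')$ and $\mathrm{V}(\boldsymbol{R}'')$. Let $T'\in\mathcal{T}'$ and $T''\in\mathcal{T}''$ be any topes such that for the unique inclusion-minimal subsets $\boldsymbol{Q}(T',\boldsymbol{R}')\subset\mathrm{V}(\boldsymbol{R}')$ and $\boldsymbol{Q}(T'',\boldsymbol{R}'')\subset\mathrm{V}(\boldsymbol{R}'')$ with the properties $$\sum_{Q'\in\boldsymbol{Q}(T',\boldsymbol{R}')}Q'=T'\quad\text{and}\quad\sum_{Q''\in\boldsymbol{Q}(T'',\boldsymbol{R}'')}Q''=T''$$ we have $$|\boldsymbol{Q}(T',\boldsymbol{R}')|\geq 5\quad\text{and}\quad|\boldsymbol{Q}(T'',\boldsymbol{R}'')|\geq 5.$$ Let $\boldsymbol{\Lambda}'$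 be the abstract simplicial complex on the vertex set $E_s$ with the facet family $\{E_s-\mathbf{S}(T',Q')\colon Q'\in\boldsymbol{Q}(T',\boldsymbol{R}')\}$, and let $\boldsymbol{\Lambda}''$ be the abstract simplicial complex on the vertex set $E_t$ with the facet family $\{E_t-\mathbf{S}(T'',Q'')\colon Q''\in\boldsymbol{Q}(T'',\boldsymbol{R}'')\}$, where $\mathbf{S}(\cdot,\cdot)$ denotes the separation set of two topes. Then the long $f$-vectors $\boldsymbol{f}(\boldsymbol{\Lambda}';t)$ and $\boldsymbol{f}(\boldsymbol{\Lambda}'';t)$ satisfy the orthogonality relation $$\bigl(\boldsymbol{\beta}(s;t)-\boldsymbol{f}(\boldsymbol{\Lambda}';t)\bigr)\,\mathbf{T}(t)^{t-s}\cdot\mathbf{M}(t)\cdot\bigl(\boldsymbol{\beta}(t;t)^{\top}-\boldsymbol{f}(\boldsymbol{\Lambda}'';t)^{\top}\bigr)=0,$$ where $\boldsymbol{\beta}(s;t)$, $\boldsymbol{\beta}(t;t)$ are the row vectors of binomial coefficients, $\mathbf{T}(t)$ is the forward shift matrix, and $\mathbf{M}(t)$ is the matrix, all of them as defined in the context.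
   Context: Oriented matroids. An oriented matroid is simple if it has no loops, parallel elements or antiparallel elements. Its topes are its maximal covectors; for a simple oriented matroid on $E_m:=[m]:=\{1,\ldots,m\}$ they are regarded as vectors in $\{1,-1\}^{E_m}$, and sums of topes are taken componentwise in $\mathbb{R}^m$. The separation set of topes $T,Q$ is $\mathbf{S}(T,Q)=\{e\in E_m\colon T(e)\neq Q(e)\}$. The tope graph has the topes as vertices, two topes being adjacent when their separation set has exactly one element (for a simple oriented matroid). A symmetric cycle (symmetric $2m$-cycle) $\boldsymbol{R}$ in the tope graph of a simple oriented matroid on $E_m$ is a cycle of length $2m$ in the tope graph whose vertex set satisfies $\mathrm{V}(\boldsymbol{R})=-\mathrm{V}(\boldsymbol{R})$. It is known that for every tope $T$ and every symmetric cycle $\boldsymbol{R}$ there is a unique inclusion-minimal subset $\boldsymbol{Q}(T,\boldsymbol{R})\subset\mathrm{V}(\boldsymbol{R})$ such that $\sum_{Q\in\boldsymbol{Q}(T,\boldsymbol{R})}Q=T$. Complexes and $f$-vectors. The abstract simplicial complex with a given facet family consists of all subsets (including the empty set) of the members of that family. For a complex $\boldsymbol{\Lambda}$ (here on $E_s$ or on $E_t$), the long $f$-vector is the row vector $\boldsymbol{f}(\boldsymbol{\Lambda};t)=(f_0(\boldsymbol{\Lambda};t),\ldots,f_t(\boldsymbol{\Lambda};t))\in\mathbb{N}^{t+1}$ with $f_j(\boldsymbol{\Lambda};t)=\#\{F\in\boldsymbol{\Lambda}\colon |F|=j\}$ for $0\le j\le t$. Vectors and matrices. Components of vectors and rows and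 columns of matrices are indexed starting from zero. Put $$\boldsymbol{\beta}(t;t)=\bigl(\tbinom{t}{0},\tbinom{t}{1},\ldots,\tbinom{t}{t}\bigr),\qquad \boldsymbol{\beta}(s;t)=\bigl(\tbinom{s}{0},\tbinom{s}{1},\ldots,\tbinom{s}{t}\bigr),$$ both row vectors with $t+1$ components (with $\tbinom{s}{j}=0$ for $j>s$). The following are square matrices of order $t+1$: the forward shift matrix $\mathbf{T}(t)$, whose $(i,j)$th entry is the Kronecker delta $\delta_{j-i,1}$; the backward identity matrix $\mathbf{U}(t)$, whose $(i,j)$th entry is $\delta_{i+j,t}$; the matrix $\mathbf{S}(t)$, whose $(i,j)$th entry is $(-1)^{j-i}\tbinom{t-i}{j-i}$ (zero for $j<i$); and $$\mathbf{M}(t):=\mathbf{U}(t)\,\mathbf{S}(t)\,\mathbf{S}(t)^{\top}\,\mathbf{U}(t),$$ whose $(i,j)$th entry is $(-1)^{i+j}\tbinom{i+j}{i}$. The superscript $\top$ denotes transposition. *)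

theory Defs
  imports "Graph_Theory.Pair_Digraph" "Jordan_Normal_Form.Matrix" Complex_Main
begin

section \<open>Oriented matroids\<close>

text \<open>
  A vector indexed by the ground set \<open>E\<close> is a function that vanishes outside \<open>E\<close>, so that equality
  of vectors is equality of functions and negation is the library's pointwise \<open>uminus\<close>.
\<close>

type_synonym 'a covector = "'a \<Rightarrow> real"

definition sign_vectors :: "'a set \<Rightarrow> 'a covector set" where
  "sign_vectors E = {X. (\<forall>e\<in>E. X e \<in> {-1, 0, 1}) \<and> (\<forall>e. e \<notin> E \<longrightarrow> X e = 0)}"

definition covector_comp :: "'a covector \<Rightarrow> 'a covector \<Rightarrow> 'a covector" where
  "covector_comp X Y = (\<lambda>e. if X e \<noteq> 0 then X e else Y e)"

text \<open>Covector axioms; in \<open>elimination\<close> the set of \<open>f\<close> with \<open>X f = - Y f \<noteq> 0\<close> is the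
  separation set of the (not necessarily maximal) covectors \<open>X\<close> and \<open>Y\<close>.\<close>

locale oriented_matroid =
  fixes E :: "'a set" and L :: "'a covector set"
  assumes finite_ground: "finite E"
    and covectors: "L \<subseteq> sign_vectors E"
    and zero: "(\<lambda>_. 0) \<in> L"
    and symmetry: "X \<in> L \<Longrightarrow> - X \<in> L"
    and composition: "X \<in> L \<Longrightarrow> Y \<in> L \<Longrightarrow> covector_comp X Y \<in> L"
    and elimination: "X \<in> L \<Longrightarrow> Y \<in> L \<Longrightarrow> X e = - Y e \<Longrightarrow> X e \<noteq> 0 \<Longrightarrow>
      \<exists>Z\<in>L. Z e = 0 \<and> (\<forall>f\<in>E. \<not> (X f = - Y f \<and> X f \<noteq> 0) \<longrightarrow> Z f = covector_comp X Y f)"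

locale simple_oriented_matroid = oriented_matroid +
  assumes no_loop: "e \<in> E \<Longrightarrow> \<exists>X\<in>L. X e \<noteq> 0"
    and no_parallel: "e \<in> E \<Longrightarrow> f \<in> E \<Longrightarrow> e \<noteq> f \<Longrightarrow> \<exists>X\<in>L. X e \<noteq> X f"
    and no_antiparallel: "e \<in> E \<Longrightarrow> f \<in> E \<Longrightarrow> e \<noteq> f \<Longrightarrow> \<exists>X\<in>L. X e \<noteq> - X f"

text \<open>Maximality refers to the componentwise order in which \<open>0\<close> lies below both \<open>1\<close> and \<open>-1\<close>.\<close>

definition covector_le :: "'a covector \<Rightarrow> 'a covector \<Rightarrow> bool" where
  "covector_le X Y \<longleftrightarrow> (\<forall>e. X e = 0 \<or> X e = Y e)"

definition topes :: "'a covector set \<Rightarrow> 'a covector set" where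
  "topes L = {T \<in> L. \<forall>X\<in>L. covector_le T X \<longrightarrow> X = T}"

definition sep :: "'a set \<Rightarrow> 'a covector \<Rightarrow> 'a covector \<Rightarrow> 'a set" where
  "sep E T Q = {e \<in> E. T e \<noteq> Q e}"

text \<open>The undirected tope graph is represented, as usual in \<open>Graph_Theory\<close>, by a symmetric digraph.\<close>

definition tope_graph :: "'a set \<Rightarrow> 'a covector set \<Rightarrow> 'a covector pair_pre_digraph" where
  "tope_graph E L = \<lparr> pverts = topes L,
     parcs = {(T, Q). T \<in> topes L \<and> Q \<in> topes L \<and> card (sep E T Q) = 1} \<rparr>"

text \<open>A cycle is given by its list of arcs; as it is closed, its vertices are the tails of its arcs.\<close>

definition cycle_verts :: "('v \<times> 'v) list \<Rightarrow> 'v set" where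
  "cycle_verts R = fst ` set R"

definition symmetric_cycle ::
  "'a set \<Rightarrow> 'a covector set \<Rightarrow> ('a covector \<times> 'a covector) list \<Rightarrow> bool" where
  "symmetric_cycle E L R \<longleftrightarrow>
     pre_digraph.cycle (with_proj (tope_graph E L)) R \<and> length R = 2 * card E \<and>
     uminus ` cycle_verts R = cycle_verts R"

definition sums_to :: "'a covector set \<Rightarrow> 'a covector \<Rightarrow> bool" where
  "sums_to \<Q> T \<longleftrightarrow> (\<lambda>e. \<Sum>Q\<in>\<Q>. Q e) = T"

definition minimal_decomposition ::
  "'a covector \<Rightarrow> 'a covector set \<Rightarrow> 'a covector set \<Rightarrow> bool" where
  "minimal_decomposition T V \<Q> \<longleftrightarrow>
     \<Q> \<subseteq> V \<and> sums_to \<Q> T \<and> (\<forall>\<P>. \<P> \<subset> \<Q> \<longrightarrow> \<not> sums_to \<P> T)"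

section \<open>Complexes and long f-vectors\<close>

definition complex_of_facets :: "'a set set \<Rightarrow> 'a set set" where
  "complex_of_facets \<F> = {A. \<exists>F\<in>\<F>. A \<subseteq> F}"

text \<open>Row vectors with \<open>t + 1\<close> components are \<open>1 \<times> (t + 1)\<close> matrices.\<close>

definition long_f_vector :: "'a set set \<Rightarrow> nat \<Rightarrow> real mat" where
  "long_f_vector \<Lambda> t = mat 1 (t + 1) (\<lambda>(_, j). real (card {F \<in> \<Lambda>. card F = j}))"

definition binom_vector :: "nat \<Rightarrow> nat \<Rightarrow> real mat" where
  "binom_vector s t = mat 1 (t + 1) (\<lambda>(_, j). real (s choose j))"

section \<open>Matrices of order \<open>t + 1\<close>\<close>

definition forward_shift :: "nat \<Rightarrow> real mat" where
  "forward_shift t = mat (t + 1) (t + 1) (\<lambda>(i, j). if j = i + 1 then 1 else 0)"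

definition backward_identity :: "nat \<Rightarrow> real mat" where
  "backward_identity t = mat (t + 1) (t + 1) (\<lambda>(i, j). if i + j = t then 1 else 0)"

definition S_mat :: "nat \<Rightarrow> real mat" where
  "S_mat t = mat (t + 1) (t + 1)
     (\<lambda>(i, j). if i \<le> j then (-1) ^ (j - i) * real ((t - i) choose (j - i)) else 0)"

definition M_mat :: "nat \<Rightarrow> real mat" where
  "M_mat t = backward_identity t * S_mat t * transpose_mat (S_mat t) * backward_identity t"

end

theory Submission
  imports Defs
begin

text \<open>
  The argument concerns the subsets that are \<^emph>\<open>not\<close> faces. Let \<open>g\<^sub>j\<close> be the number of non-faces of
  size \<open>j\<close> of the complex \<open>\<Lambda>\<close> of a tope \<open>T\<close> on a ground set \<open>E\<close> with \<open>n\<close> elements; the vector \<open>g\<close>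
  is the difference of the binomial vector and the long f-vector.

  The heart of the matter is that \<open>\<Sum> (-1)\<^bsup>card A\<^esup> = 1\<close>, where \<open>A\<close> runs over the faces of \<open>\<Lambda>\<close>
  contained in a fixed non-face \<open>C\<close>: restricted to a non-face, the complex has the Euler
  characteristic of a circle. To see this, observe that along a symmetric cycle of length \<open>2n\<close> each
  element of \<open>E\<close> changes sign exactly twice, at two opposite edges
  (\<open>symmetric_cycle_normal_form\<close>). So the vertices that agree with \<open>T\<close> at \<open>e\<close> form a half-circle \<open>H\<^sub>e\<close>,
  and the half-circles of distinct elements are neither equal nor complementary. Say that \<open>a\<close> precedes \<open>b\<close> if \<open>H\<^sub>b\<close> starts inside
  \<open>H\<^sub>a\<close>; this is a tournament on \<open>E\<close>. A nonempty set \<open>A\<close> of elements has a source if and only if it has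
  a sink, if and only if the \<open>H\<^sub>e\<close> with \<open>e \<in> A\<close> have a common vertex; as any two half-circles share a
  vertex of the decomposition of \<open>T\<close> (by \<open>T = \<Sum> Q\<close>), this common vertex can be taken in the
  decomposition, that is, \<open>A\<close> is a face. Now classify the nonempty faces \<open>A \<subseteq> C\<close> by their source \<open>a\<close>: the
  remaining elements of \<open>A\<close> form an arbitrary subset of the set of successors of \<open>a\<close> in \<open>C\<close>, which is
  nonempty because \<open>C\<close>, a non-face, has no sink. So the alternating sum over each class
  vanishes, and only the empty face contributes
  (\<open>alternating_sum_tournament_complex\<close>, \<open>agreement_complex_alternating_sum\<close>).

  Counting the pairs of non-faces \<open>A \<subseteq> C\<close> with \<open>card C = k\<close> turns this into Dehn-Sommerville type relations:
  \<open>\<Sum>\<^sub>i (-1)\<^sup>i g\<^sub>i ((n - i) choose (k - i)) = - g\<^sub>k\<close> for all \<open>k\<close> (\<open>nonface_count_relation\<close>). Shifting the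
  vector of \<open>\<Lambda>'\<close> by \<open>t - s\<close> positions gives relations of the same form with \<open>n = t\<close>, and as \<open>t - s\<close> is odd,
  the sign on the right becomes \<open>+\<close>. In terms of the vector \<open>v U S\<close>, where
  \<open>U\<close> is the backward identity matrix and \<open>S\<close> the matrix \<open>S_mat t\<close>, such relations say that \<open>v U S\<close> is antisymmetric for \<open>\<Lambda>''\<close> and symmetric
  for the shifted vector of \<open>\<Lambda>'\<close> (\<open>signed_binomial_transform_reverse\<close>). Since
  \<open>M = (U S) (U S)\<^sup>T\<close>, the matrix product in question is the scalar product of a symmetric and an
  antisymmetric vector, hence zero.
\<close>

section \<open>Alternating sums over faces\<close>

lemma sum_alternating_Pow:
  assumes "finite D" and "D \<noteq> {}"
  shows "(\<Sum>A\<in>Pow D. (- 1 :: real) ^ card A) = 0"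
  using prod_diff_conv_sum[OF assms(1), of "\<lambda>_. 1 :: real" "\<lambda>_. 1"] assms
  by (simp add: zero_power card_gt_0_iff)

text \<open>The sum is taken over the faces inside \<open>C\<close>, a set without sink in the tournament \<open>r\<close>, in a complex
  whose nonempty faces inside \<open>C\<close> are the sets with a source. The source of such a set is unique, and the
  faces with source \<open>a\<close> correspond to the subsets of the nonempty set of successors of \<open>a\<close>.\<close>

lemma alternating_sum_tournament_complex:
  fixes r :: "'a \<Rightarrow> 'a \<Rightarrow> bool"
  assumes fin: "finite C"
    and tournament: "\<And>a b. a \<in> C \<Longrightarrow> b \<in> C \<Longrightarrow> a \<noteq> b \<Longrightarrow> r a b \<Longrightarrow> \<not> r b a"
    and empty: "{} \<in> \<Lambda>"
    and faces: "\<And>A. A \<subseteq> C \<Longrightarrow> A \<noteq> {} \<Longrightarrow> A \<in> \<Lambda> \<longleftrightarrow> (\<exists>a\<in>A. \<forall>b\<in>A - {a}. r a b)"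
    and no_sink: "\<And>a. a \<in> C \<Longrightarrow> \<exists>b\<in>C - {a}. r a b"
  shows "(\<Sum>A | A \<subseteq> C \<and> A \<in> \<Lambda>. (- 1 :: real) ^ card A) = 1"
proof -
  define D where "D a = {b \<in> C - {a}. r a b}" for a
  define F where "F a = insert a ` Pow (D a)" for a
  have finD: "finite (D a)" for a
    using fin by (simp add: D_def)
  have split: "{A. A \<subseteq> C \<and> A \<in> \<Lambda>} = insert {} (\<Union>a\<in>C. F a)"
  proof (intro equalityI subsetI)
    fix A assume A: "A \<in> {A. A \<subseteq> C \<and> A \<in> \<Lambda>}"
    show "A \<in> insert {} (\<Union>a\<in>C. F a)"
    proof (cases "A = {}")
      case False
      with A faces[of A] obtain a where a: "a \<in> A" "\<forall>b\<in>A - {a}. r a b"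
        by blast
      then have "A - {a} \<subseteq> D a" "A = insert a (A - {a})"
        using A by (auto simp: D_def)
      then have "A \<in> F a"
        unfolding F_def by blast
      then show ?thesis
        using a A by auto
    qed simp
  next
    fix A assume "A \<in> insert {} (\<Union>a\<in>C. F a)"
    then consider "A = {}" | a B where "a \<in> C" "A = insert a B" "B \<subseteq> D a"
      by (auto simp: F_def)
    then show "A \<in> {A. A \<subseteq> C \<and> A \<in> \<Lambda>}"
    proof cases
      case 2
      then have "A \<subseteq> C" "\<forall>b\<in>A - {a}. r a b" "a \<in> A"
        by (auto simp: D_def)
      then show ?thesis
        using faces[of A] by auto
    qed (use empty in auto)
  qed
  have sumF: "(\<Sum>A\<in>F a. (- 1 :: real) ^ card A) = 0" if "a \<in> C" for a
  proof -
    have "a \<notin> D a"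
      by (simp add: D_def)
    then have inj: "inj_on (insert a) (Pow (D a))"
      by (auto simp: inj_on_def)
    have "card (insert a B) = Suc (card B)" if "B \<in> Pow (D a)" for B
      using that \<open>a \<notin> D a\<close> finite_subset[OF _ finD[of a], of B] by (auto simp: card_insert_if)
    then have "(\<Sum>A\<in>F a. (- 1 :: real) ^ card A) = (\<Sum>B\<in>Pow (D a). - ((- 1) ^ card B))"
      unfolding F_def by (simp add: sum.reindex[OF inj])
    also have "\<dots> = 0"
      using sum_alternating_Pow[of "D a"] finD no_sink[OF that] by (auto simp: sum_negf D_def)
    finally show ?thesis .
  qed
  have disj: "F a \<inter> F b = {}" if "a \<in> C" "b \<in> C" "a \<noteq> b" for a b
  proof (rule ccontr)
    assume "F a \<inter> F b \<noteq> {}"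
    then obtain A where "A \<in> F a" "A \<in> F b"
      by auto
    then have "b \<in> D a" "a \<in> D b"
      using that by (auto simp: F_def)
    then show False
      using tournament that by (auto simp: D_def)
  qed
  have "(\<Sum>A | A \<subseteq> C \<and> A \<in> \<Lambda>. (- 1 :: real) ^ card A)
      = 1 + (\<Sum>A\<in>(\<Union>a\<in>C. F a). (- 1) ^ card A)"
    unfolding split using fin finD by (subst sum.insert) (auto simp: F_def)
  also have "(\<Sum>A\<in>(\<Union>a\<in>C. F a). (- 1 :: real) ^ card A) = (\<Sum>a\<in>C. \<Sum>A\<in>F a. (- 1) ^ card A)"
    using fin finD disj by (intro sum.UNION_disjoint) (auto simp: F_def)
  finally show ?thesis
    using sumF by simp
qed

text \<open>
  Cut a symmetric cycle at a vertex \<open>X\<close> and let \<open>k e\<close> be the position of the first edge at which \<open>e\<close>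
  changes sign. The vertex reached after \<open>j\<close> steps, with \<open>j\<close> at most half the length of the cycle, has the
  value \<open>X e\<close> at \<open>e\<close> if \<open>j \<le> k e\<close>, and \<open>- X e\<close> otherwise. If \<open>p e\<close> says that \<open>X\<close>
  agrees with the tope \<open>T\<close> at \<open>e\<close>, then \<open>agreement_set k p j \<sigma>\<close> consists of the elements at which this
  vertex (if \<open>\<sigma>\<close> is true) or its negative (if \<open>\<sigma>\<close> is false) agrees with \<open>T\<close>.
\<close>

definition agreement_set :: "('a \<Rightarrow> nat) \<Rightarrow> ('a \<Rightarrow> bool) \<Rightarrow> nat \<Rightarrow> bool \<Rightarrow> 'a set" where
  "agreement_set k p j \<sigma> = {e. p e \<longleftrightarrow> (\<sigma> \<longleftrightarrow> j \<le> k e)}"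

text \<open>The elements \<open>a\<close> and \<open>z\<close> obtained here are the source and the sink of \<open>A\<close>: the elements whose
  half-circles start first and last among those containing a given vertex.\<close>

lemma agreement_set_extremes:
  assumes "finite A" and "A \<noteq> {}" and "A \<subseteq> agreement_set k p j \<sigma>"
  obtains a z where "a \<in> A" and "z \<in> A"
    and "\<And>e. e \<in> A \<Longrightarrow> ((p e \<longleftrightarrow> p a) \<longleftrightarrow> k a \<le> k e)"
    and "\<And>e. e \<in> A \<Longrightarrow> ((p e \<longleftrightarrow> p z) \<longleftrightarrow> k e \<le> k z)"
proof -
  define m where "m = Suc (Max (k ` A))"
  \<comment> \<open>\<open>key\<close> is the order in which the elements of \<open>A\<close> change sign on the way from the vertex at
    position \<open>j\<close> to its negative; the \<open>k\<close>-values below \<open>j\<close> come round a second time.\<close>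
  define key where "key e = (if j \<le> k e then k e else k e + m)" for e
  have less: "k e < m" if "e \<in> A" for e
    using that assms(1) by (simp add: m_def less_Suc_eq_le)
  obtain a where a: "a \<in> A" "\<And>e. e \<in> A \<Longrightarrow> key a \<le> key e"
    using obtains_MIN[OF assms(1,2), of key] assms(1,2)
    by (metis finite_imageI Min_le imageI)
  obtain z where z: "z \<in> A" "\<And>e. e \<in> A \<Longrightarrow> key e \<le> key z"
    using obtains_MAX[OF assms(1,2), of key] assms(1,2)
    by (metis finite_imageI Max_ge imageI)
  have half: "p e \<longleftrightarrow> (\<sigma> \<longleftrightarrow> j \<le> k e)" if "e \<in> A" for e
    using assms(3) that by (auto simp: agreement_set_def)
  show thesis
  proof (rule that[OF a(1) z(1)])
    fix e assume "e \<in> A"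
    show "(p e \<longleftrightarrow> p a) \<longleftrightarrow> k a \<le> k e"
      using half[OF \<open>e \<in> A\<close>] half[OF a(1)] a(2)[OF \<open>e \<in> A\<close>] less[OF \<open>e \<in> A\<close>] less[OF a(1)]
      by (auto simp: key_def split: if_splits)
    show "(p e \<longleftrightarrow> p z) \<longleftrightarrow> k e \<le> k z"
      using half[OF \<open>e \<in> A\<close>] half[OF z(1)] z(2)[OF \<open>e \<in> A\<close>] less[OF \<open>e \<in> A\<close>] less[OF z(1)]
      by (auto simp: key_def split: if_splits)
  qed
qed

text \<open>The precedence of \<open>a\<close> over \<open>b\<close> on the circle reads \<open>(p a \<longleftrightarrow> p b) \<longleftrightarrow> k a < k b\<close>.\<close>

lemma agreement_complex_alternating_sum:
  fixes k :: "'a \<Rightarrow> nat"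
  assumes fin: "finite E" and inj: "inj_on k E"
    and facets: "\<And>F. F \<in> \<F> \<Longrightarrow> \<exists>j \<sigma>. F = E \<inter> agreement_set k p j \<sigma>"
    and pairs: "\<And>a b. a \<in> E \<Longrightarrow> b \<in> E \<Longrightarrow> \<exists>F\<in>\<F>. a \<in> F \<and> b \<in> F"
    and "\<F> \<noteq> {}" and "C \<subseteq> E" and nonface: "C \<notin> complex_of_facets \<F>"
  shows "(\<Sum>A | A \<subseteq> C \<and> A \<in> complex_of_facets \<F>. (- 1 :: real) ^ card A) = 1"
proof (rule alternating_sum_tournament_complex
    [where r = "\<lambda>a b. (p a \<longleftrightarrow> p b) \<longleftrightarrow> k a < k b"])
  \<comment> \<open>A set on which some vertex of the cycle agrees with the tope lies in a facet: a facet
    that contains its source and its sink contains everything between them.\<close>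
  have face: "A \<in> complex_of_facets \<F>" if sub: "A \<subseteq> E" "A \<subseteq> agreement_set k p j \<sigma>" for A j \<sigma>
  proof (cases "A = {}")
    case True
    then show ?thesis
      using \<open>\<F> \<noteq> {}\<close> by (auto simp: complex_of_facets_def)
  next
    case False
    obtain a z where az: "a \<in> A" "z \<in> A"
      and a: "\<And>e. e \<in> A \<Longrightarrow> ((p e \<longleftrightarrow> p a) \<longleftrightarrow> k a \<le> k e)"
      and z: "\<And>e. e \<in> A \<Longrightarrow> ((p e \<longleftrightarrow> p z) \<longleftrightarrow> k e \<le> k z)"
      using agreement_set_extremes[OF finite_subset[OF sub(1) fin] False sub(2)] by blast
    obtain F where F: "F \<in> \<F>" "a \<in> F" "z \<in> F"
      using pairs az sub(1) by blast
    obtain i \<tau> where i: "F = E \<inter> agreement_set k p i \<tau>"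
      using facets[OF F(1)] by blast
    have "e \<in> F" if "e \<in> A" for e
      using F(2,3) a[OF that] z[OF that] a[OF az(2)] that \<open>A \<subseteq> E\<close>
      unfolding i agreement_set_def by (cases "p e"; cases "p a"; cases "p z"; cases \<tau>; auto)
    then show ?thesis
      using F(1) by (auto simp: complex_of_facets_def)
  qed
  show "finite C"
    using \<open>C \<subseteq> E\<close> fin by (rule finite_subset)
  show "{} \<in> complex_of_facets \<F>"
    using \<open>\<F> \<noteq> {}\<close> by (auto simp: complex_of_facets_def)
  have neq: "k a \<noteq> k b" if "a \<in> C" "b \<in> C" "a \<noteq> b" for a b
    using that inj \<open>C \<subseteq> E\<close> by (auto simp: inj_on_def)
  show "\<not> ((p b \<longleftrightarrow> p a) \<longleftrightarrow> k b < k a)"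
    if "a \<in> C" "b \<in> C" "a \<noteq> b" "(p a \<longleftrightarrow> p b) \<longleftrightarrow> k a < k b" for a b
    using that neq[OF that(1-3)] by auto
  show "A \<in> complex_of_facets \<F> \<longleftrightarrow> (\<exists>a\<in>A. \<forall>b\<in>A - {a}. (p a \<longleftrightarrow> p b) \<longleftrightarrow> k a < k b)"
    if A: "A \<subseteq> C" "A \<noteq> {}" for A
  proof
    assume "A \<in> complex_of_facets \<F>"
    then obtain F where "F \<in> \<F>" "A \<subseteq> F"
      by (auto simp: complex_of_facets_def)
    then obtain j \<sigma> where "A \<subseteq> agreement_set k p j \<sigma>"
      using facets by blast
    then obtain a where a: "a \<in> A" "\<And>e. e \<in> A \<Longrightarrow> ((p e \<longleftrightarrow> p a) \<longleftrightarrow> k a \<le> k e)"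
      using agreement_set_extremes[of A k p j \<sigma>] A \<open>C \<subseteq> E\<close> fin finite_subset by metis
    have "(p a \<longleftrightarrow> p b) \<longleftrightarrow> k a < k b" if "b \<in> A - {a}" for b
    proof -
      have "k a \<noteq> k b"
        using neq[of a b] a(1) that A by auto
      then show ?thesis
        using a(2)[of b] that by auto
    qed
    then show "\<exists>a\<in>A. \<forall>b\<in>A - {a}. (p a \<longleftrightarrow> p b) \<longleftrightarrow> k a < k b"
      using a(1) by blast
  next
    assume "\<exists>a\<in>A. \<forall>b\<in>A - {a}. (p a \<longleftrightarrow> p b) \<longleftrightarrow> k a < k b"
    then obtain a where a: "a \<in> A" "\<And>b. b \<in> A - {a} \<Longrightarrow> (p a \<longleftrightarrow> p b) \<longleftrightarrow> k a < k b"
      by blast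
    \<comment> \<open>The half-circles of the elements of \<open>A\<close> all contain the last vertex of that of the source \<open>a\<close>.\<close>
    have "e \<in> agreement_set k p (k a) (p a)" if "e \<in> A" for e
    proof (cases "e = a")
      case False
      then have "k a \<noteq> k e"
        using neq[of a e] a(1) that A by auto
      then show ?thesis
        using a(2)[of e] that False by (auto simp: agreement_set_def)
    qed (simp add: agreement_set_def)
    then show "A \<in> complex_of_facets \<F>"
      using face[of A "k a" "p a"] A \<open>C \<subseteq> E\<close> by blast
  qed
  show "\<exists>b\<in>C - {a}. (p a \<longleftrightarrow> p b) \<longleftrightarrow> k a < k b" if "a \<in> C" for a
  proof (rule ccontr)
    assume no: "\<not> (\<exists>b\<in>C - {a}. (p a \<longleftrightarrow> p b) \<longleftrightarrow> k a < k b)"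
    \<comment> \<open>A sink \<open>a\<close> makes \<open>C\<close> a face: the vertex in question is the first one of the half-circle of \<open>a\<close>.\<close>
    have "e \<in> agreement_set k p (Suc (k a)) (\<not> p a)" if "e \<in> C" for e
    proof (cases "e = a")
      case False
      then have "k a \<noteq> k e"
        using neq[of a e] \<open>a \<in> C\<close> that by auto
      moreover have "\<not> ((p a \<longleftrightarrow> p e) \<longleftrightarrow> k a < k e)"
        using no that False by blast
      ultimately show ?thesis
        by (auto simp: agreement_set_def)
    qed (simp add: agreement_set_def)
    then show False
      using face[of C "Suc (k a)" "\<not> p a"] nonface \<open>C \<subseteq> E\<close> by blast
  qed
qed

section \<open>Signs along a symmetric cycle\<close>

lemma (in simple_oriented_matroid) tope_sign:
  assumes "T \<in> topes L" and "e \<in> E"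
  shows "T e \<in> {1, - 1}"
proof -
  have T: "T \<in> L" and max: "\<And>X. X \<in> L \<Longrightarrow> covector_le T X \<Longrightarrow> X = T"
    using assms(1) by (auto simp: topes_def)
  obtain X where X: "X \<in> L" "X e \<noteq> 0"
    using no_loop[OF assms(2)] by blast
  have "covector_comp T X = T"
    using composition[OF T X(1)] by (intro max) (auto simp: covector_le_def covector_comp_def)
  then have "T e \<noteq> 0"
    using X(2) by (metis covector_comp_def)
  then show ?thesis
    using T covectors assms(2) by (auto simp: sign_vectors_def)
qed

lemma symmetric_cycle_enumeration:
  assumes cyc: "symmetric_cycle E L R" and "E \<noteq> {}" and "finite E"
  obtains w :: "nat \<Rightarrow> 'a covector"
  where "cycle_verts R = w ` {..<2 * card E}" and "inj_on w {..<2 * card E}"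
    and "w (2 * card E) = w 0"
    and "\<And>i. w i \<in> topes L"
    and "\<And>i. i < 2 * card E \<Longrightarrow> card (sep E (w i) (w (Suc i))) = 1"
proof -
  interpret G: pre_digraph "with_proj (tope_graph E L)" .
  define n where "n = 2 * card E"
  define w where "w i = fst (R ! (i mod n))" for i
  have n: "0 < n" "length R = n"
    using assms by (auto simp: symmetric_cycle_def n_def card_gt_0_iff)
  obtain u where walk: "G.awalk u R u" and dist: "distinct (tl (G.awalk_verts u R))"
    using cyc by (auto simp: symmetric_cycle_def G.cycle_def)
  have arcs: "set R \<subseteq> parcs (tope_graph E L)" and cas: "G.cas u R u"
    using walk by (auto simp: G.awalk_def)
  have verts: "G.awalk_verts u R = map fst R @ [snd (last R)]"
    "G.awalk_verts u R = fst (hd R) # map snd R"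
    using n G.awalk_verts_conv[of u R] G.awalk_verts_conv'[OF cas] by auto
  have "fst (hd R) = u"
    using cas n by (cases R) auto
  moreover have "snd (last R) = u"
    using cas n by (induction R arbitrary: u rule: rev_induct) (auto simp: G.cas_append_iff)
  ultimately have closed: "snd (last R) = fst (hd R)"
    by simp
  have step: "w (Suc i) = snd (R ! i)" if "i < n" for i
  proof (cases "Suc i = n")
    case True
    show ?thesis
    proof -
      have "R \<noteq> []" "i = length R - 1"
        using n True by auto
      then have "last R = R ! i" "hd R = R ! 0"
        by (simp_all add: last_conv_nth hd_conv_nth)
      then show ?thesis
        using closed True by (simp add: w_def)
    qed
  next
    case False
    then have "(map fst R @ [snd (last R)]) ! Suc i = fst (R ! Suc i)"
      using that n by (simp add: nth_append)
    moreover have "map fst R @ [snd (last R)] = fst (hd R) # map snd R"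
      using verts by simp
    ultimately show ?thesis
      using that False n by (simp add: w_def)
  qed
  have arc: "R ! i = (w i, w (Suc i))" if "i < n" for i
    using that step by (simp add: w_def prod_eq_iff)
  have in_arcs: "(w i, w (Suc i)) \<in> parcs (tope_graph E L)" if "i < n" for i
    using arc[OF that] arcs that n nth_mem[of i R] by auto
  have fst_eq: "map fst R = map w [0..<n]"
    using n by (intro nth_equalityI) (auto simp: w_def)
  have set_eq: "set (map snd R) = set (map fst R)"
  proof -
    have "map snd R = map (\<lambda>i. w (Suc i)) [0..<n]"
      using n step by (intro nth_equalityI) auto
    then have "set (map snd R) = w ` Suc ` {..<n}"
      by (auto simp: image_image)
    also have "\<dots> = w ` {..<n}"
    proof -
      have "w n = w 0"
        by (simp add: w_def)
      have "w (Suc i) \<in> w ` {..<n}" for i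
        by (rule image_eqI[of _ _ "Suc i mod n"]) (use n in \<open>simp_all add: w_def\<close>)
      then have "w ` Suc ` {..<n} \<subseteq> w ` {..<n}"
        by blast
      moreover have "w i \<in> w ` Suc ` {..<n}" if "i < n" for i
      proof (cases i)
        case 0
        then have "w i = w (Suc (n - 1))"
          using \<open>w n = w 0\<close> n by simp
        then show ?thesis
          unfolding image_image using n by (intro image_eqI[of _ _ "n - 1"]) simp_all
      next
        case (Suc j)
        then show ?thesis
          using that by (intro imageI) auto
      qed
      ultimately show ?thesis
        by blast
    qed
    finally show ?thesis
      by (simp add: fst_eq atLeast0LessThan del: set_map flip: set_map) (simp add: atLeast0LessThan)
  qed
  have "distinct (map snd R)"
    using dist unfolding verts(2) by simp
  then have "distinct (map fst R)"
    using set_eq by (metis card_distinct distinct_card length_map)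
  then have "inj_on w {..<n}"
    unfolding fst_eq by (simp add: distinct_map atLeast0LessThan)
  moreover have "cycle_verts R = w ` {..<n}"
    using arg_cong[OF fst_eq, of set] by (simp add: cycle_verts_def atLeast0LessThan)
  moreover have "w n = w 0"
    by (simp add: w_def)
  moreover have "w i \<in> topes L" for i
    using in_arcs[of "i mod n"] n by (simp add: w_def tope_graph_def)
  moreover have "card (sep E (w i) (w (Suc i))) = 1" if "i < n" for i
    using in_arcs[OF that] by (simp add: tope_graph_def)
  ultimately show thesis
    using that unfolding n_def by blast
qed

lemma sign_prefix_product:
  fixes f :: "nat \<Rightarrow> real"
  assumes "\<And>i. f i \<in> {1, - 1}"
  shows "f i = f 0 * (- 1) ^ card {l. l < i \<and> f l \<noteq> f (Suc l)}"
proof (induction i)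
  case (Suc i)
  have "{l. l < Suc i \<and> f l \<noteq> f (Suc l)} =
      (if f i = f (Suc i) then {} else {i}) \<union> {l. l < i \<and> f l \<noteq> f (Suc l)}"
    by (auto simp: less_Suc_eq)
  moreover have "f i \<noteq> f (Suc i) \<Longrightarrow> f (Suc i) = - f i"
    using assms[of i] assms[of "Suc i"] by auto
  ultimately show ?case
    using Suc by auto
qed simp

text \<open>The value \<open>k e\<close> is the first of the two positions on the cycle, half its length apart, at which the
  sign of \<open>e\<close> changes; \<open>X\<close> is the starting vertex. The factor \<open>c\<close> is \<open>1\<close> on the first half of the cycle
  and \<open>- 1\<close> on the second.\<close>

lemma (in simple_oriented_matroid) symmetric_cycle_normal_form:
  assumes cyc: "symmetric_cycle E L R" and "E \<noteq> {}"
  obtains k :: "'a \<Rightarrow> nat" and X :: "'a covector"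
  where "inj_on k E" and "\<forall>e\<in>E. X e \<in> {1, - 1}"
    and "\<forall>Q\<in>cycle_verts R.
      \<exists>j. \<exists>c\<in>{1, - 1}. \<forall>e\<in>E. Q e = c * (if j \<le> k e then X e else - X e)"
proof -
  define m where "m = card E"
  obtain w where V: "cycle_verts R = w ` {..<2 * m}" and inj: "inj_on w {..<2 * m}"
    and closed: "w (2 * m) = w 0" and tope: "\<And>i. w i \<in> topes L"
    and sep: "\<And>i. i < 2 * m \<Longrightarrow> card (sep E (w i) (w (Suc i))) = 1"
    using symmetric_cycle_enumeration[OF assms finite_ground] unfolding m_def by blast
  have sym: "uminus ` cycle_verts R = cycle_verts R"
    using cyc by (simp add: symmetric_cycle_def)
  have neg: "- Q \<in> cycle_verts R" if "Q \<in> cycle_verts R" for Q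
    using sym imageI[OF that, of uminus] by simp
  have "0 < m"
    using \<open>E \<noteq> {}\<close> finite_ground by (simp add: m_def card_gt_0_iff)
  have sgn: "w i e \<in> {1, - 1}" if "e \<in> E" for i e
    using tope_sign[OF tope that] .
  define P where "P e = {l. l < 2 * m \<and> w l e \<noteq> w (Suc l) e}" for e
  have finP: "finite (P e)" for e
    by (simp add: P_def)
  have prefix: "w i e = w 0 e * (- 1) ^ card {l \<in> P e. l < i}" if "e \<in> E" "i \<le> 2 * m" for i e
  proof -
    have "{l \<in> P e. l < i} = {l. l < i \<and> w l e \<noteq> w (Suc l) e}"
      using that by (auto simp: P_def)
    then show ?thesis
      using sign_prefix_product[of "\<lambda>i. w i e" i] sgn[OF that(1)] by simp
  qed
  \<comment> \<open>The sign of \<open>e\<close> changes an even number of times on a closed walk, and it does change, since the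
    vertex set is symmetric.\<close>
  have two: "2 \<le> card (P e)" if "e \<in> E" for e
  proof -
    have "even (card (P e))"
    proof -
      have "{l \<in> P e. l < 2 * m} = P e"
        by (auto simp: P_def)
      then have "w 0 e = w 0 e * (- 1) ^ card (P e)"
        using prefix[OF that, of "2 * m"] closed by simp
      then show ?thesis
        using sgn[OF that, of 0] by (cases "even (card (P e))") auto
    qed
    moreover have "P e \<noteq> {}"
    proof
      assume none: "P e = {}"
      have "w 0 \<in> cycle_verts R"
        using V \<open>0 < m\<close> by auto
      then have "- w 0 \<in> cycle_verts R"
        by (rule neg)
      then obtain j where "j < 2 * m" "w j = - w 0"
        using V by auto
      then show False
        using prefix[OF that, of j] none sgn[OF that, of 0] by auto
    qed
    then have "card (P e) \<noteq> 0"
      using finP by simp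
    ultimately show ?thesis
      by (cases "card (P e) = 1") auto
  qed
  \<comment> \<open>Each of the \<open>2 * m\<close> edges changes the sign of a single element, so that \<open>two\<close> holds with equality.\<close>
  have "(\<Sum>e\<in>E. card (P e)) = (\<Sum>e\<in>E. 2)"
  proof -
    have "(\<Sum>e\<in>E. card (P e)) = (\<Sum>e\<in>E. \<Sum>l<2 * m. if w l e \<noteq> w (Suc l) e then 1 else 0)"
      by (intro sum.cong refl) (simp add: P_def flip: sum.inter_filter)
    also have "\<dots> = (\<Sum>l<2 * m. \<Sum>e\<in>E. if w l e \<noteq> w (Suc l) e then 1 else 0)"
      by (rule sum.swap)
    also have "\<dots> = (\<Sum>l<2 * m. card (sep E (w l) (w (Suc l))))"
      using finite_ground by (intro sum.cong refl) (simp add: sep_def flip: sum.inter_filter)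
    also have "\<dots> = 2 * m"
      using sep by simp
    finally show ?thesis
      by (simp add: m_def)
  qed
  then have card_P: "card (P e) = 2" if "e \<in> E" for e
    using sum_mono_inv[of "\<lambda>_. 2" E "\<lambda>e. card (P e)" e] two that finite_ground by simp
  \<comment> \<open>By symmetry of the vertex set, both signs of \<open>e\<close> occur equally often; so the two sign changes
    are \<open>m\<close> steps apart.\<close>
  have half: "card {i \<in> {..<2 * m}. w i e = c} = m" if "e \<in> E" "c \<in> {1, - 1}" for e c
  proof -
    let ?V = "\<lambda>c. {Q \<in> cycle_verts R. Q e = c}"
    have card_V: "card (?V c) = card {i \<in> {..<2 * m}. w i e = c}" for c
    proof -
      have "?V c = w ` {i \<in> {..<2 * m}. w i e = c}"
        using V by auto
      moreover have "inj_on w {i \<in> {..<2 * m}. w i e = c}"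
        by (rule inj_on_subset[OF inj]) auto
      ultimately show ?thesis
        by (simp add: card_image)
    qed
    have neg_V: "?V (- c) = uminus ` ?V c" for c
    proof (intro equalityI subsetI)
      fix Q assume "Q \<in> ?V (- c)"
      then have "- Q \<in> ?V c"
        using neg[of Q] by simp
      then show "Q \<in> uminus ` ?V c"
        by (intro image_eqI[of _ _ "- Q"]) (simp_all add: fun_eq_iff)
    next
      fix Q assume "Q \<in> uminus ` ?V c"
      then show "Q \<in> ?V (- c)"
        using neg by auto
    qed
    have "inj_on uminus (?V c)"
      by (auto simp: inj_on_def fun_eq_iff)
    then have "card (?V (- c)) = card (?V c)"
      unfolding neg_V by (rule card_image)
    moreover have "card (?V c) + card (?V (- c)) = 2 * m"
    proof -
      have "card (?V c) + card (?V (- c)) = card (?V c \<union> ?V (- c))"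
        using V that(2) by (intro card_Un_disjoint[symmetric]) auto
      also have "?V c \<union> ?V (- c) = cycle_verts R"
      proof -
        have "w i e = c \<or> w i e = - c" for i
          using sgn[OF that(1), of i] that(2) by auto
        then show ?thesis
          using V by auto
      qed
      finally show ?thesis
        using V inj by (simp add: card_image)
    qed
    ultimately show ?thesis
      using card_V by simp
  qed
  have "\<exists>x<m. P e = {x, x + m}" if e: "e \<in> E" for e
  proof -
    obtain x y where xy: "P e = {x, y}" "x < y"
    proof -
      obtain x y where "P e = {x, y}" "x \<noteq> y"
        using card_P[OF e] by (auto simp: card_2_iff)
      then show thesis
        using that[of x y] that[of y x] by (cases "x < y") (auto simp: insert_commute)
    qed
    have "y < 2 * m"
      using xy by (auto simp: P_def)
    have val: "w i e = (if x < i \<and> i \<le> y then - w 0 e else w 0 e)" if "i < 2 * m" for i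
    proof -
      have "{l \<in> P e. l < i} = (if i \<le> x then {} else if i \<le> y then {x} else {x, y})"
        using xy by auto
      then show ?thesis
        using prefix[OF \<open>e \<in> E\<close>, of i] that xy(2) by auto
    qed
    have "{i \<in> {..<2 * m}. w i e = - w 0 e} = {x<..y}"
    proof (rule Set.set_eqI)
      fix i
      show "i \<in> {i \<in> {..<2 * m}. w i e = - w 0 e} \<longleftrightarrow> i \<in> {x<..y}"
      proof (cases "i < 2 * m")
        case True
        then show ?thesis
          unfolding mem_Collect_eq val[OF True] using sgn[OF \<open>e \<in> E\<close>, of 0] by auto
      qed (use \<open>y < 2 * m\<close> in auto)
    qed
    then have "y - x = m"
      using half[OF \<open>e \<in> E\<close>, of "- w 0 e"] sgn[OF \<open>e \<in> E\<close>, of 0] by auto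
    then have "y = x + m" "x < m"
      using xy(2) \<open>y < 2 * m\<close> by simp_all
    then show ?thesis
      using xy(1) by blast
  qed
  then have "\<exists>k. \<forall>e\<in>E. k e < m \<and> P e = {k e, k e + m}"
    by (intro bchoice) blast
  then obtain k where k: "\<And>e. e \<in> E \<Longrightarrow> k e < m" "\<And>e. e \<in> E \<Longrightarrow> P e = {k e, k e + m}"
    by blast
  have val: "w i e = (if k e < i \<and> i \<le> k e + m then - w 0 e else w 0 e)"
    if "e \<in> E" "i < 2 * m" for i e
  proof -
    have "{l \<in> P e. l < i} = (if i \<le> k e then {} else if i \<le> k e + m then {k e} else {k e, k e + m})"
      using k[OF that(1)] by auto
    then show ?thesis
      using prefix[OF that(1), of i] that \<open>0 < m\<close> by auto
  qed
  show thesis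
  proof (rule that[of k "w 0"])
    show "inj_on k E"
    proof (rule inj_onI)
      fix a b assume ab: "a \<in> E" "b \<in> E" "k a = k b"
      then have "a \<in> sep E (w (k a)) (w (Suc (k a)))" "b \<in> sep E (w (k a)) (w (Suc (k a)))"
        using k(2)[of a] k(2)[of b] by (auto simp: P_def sep_def)
      moreover have "card (sep E (w (k a)) (w (Suc (k a)))) = 1"
        using sep k(1)[OF ab(1)] by simp
      ultimately show "a = b"
        by (auto simp: card_1_singleton_iff)
    qed
    show "\<forall>e\<in>E. w 0 e \<in> {1, - 1}"
      using sgn by blast
  next
    show "\<forall>Q\<in>cycle_verts R. \<exists>j. \<exists>c\<in>{1, - 1}. \<forall>e\<in>E.
      Q e = c * (if j \<le> k e then w 0 e else - w 0 e)"
    proof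
      fix Q assume "Q \<in> cycle_verts R"
      then obtain i where i: "i < 2 * m" "Q = w i"
        using V by auto
      show "\<exists>j. \<exists>c\<in>{1, - 1}. \<forall>e\<in>E. Q e = c * (if j \<le> k e then w 0 e else - w 0 e)"
      proof (cases "i < m")
        case True
        have "Q e = 1 * (if i \<le> k e then w 0 e else - w 0 e)" if "e \<in> E" for e
          unfolding i(2) val[OF that i(1)] using True by simp
        then show ?thesis
          by (intro exI[of _ i] bexI[of _ 1]) simp_all
      next
        case False
        have "Q e = - 1 * (if i - m \<le> k e then w 0 e else - w 0 e)" if "e \<in> E" for e
          unfolding i(2) val[OF that i(1)] using i(1) False k(1)[OF that] by auto
        then show ?thesis
          by (intro exI[of _ "i - m"] bexI[of _ "- 1"]) simp_all
      qed
    qed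
  qed
qed

section \<open>Dehn-Sommerville relations for the non-faces\<close>

text \<open>The number of subsets of \<open>E\<close> of size \<open>i\<close> that are not faces, as a real number.\<close>

definition nonface_count :: "'a set \<Rightarrow> 'a set set \<Rightarrow> nat \<Rightarrow> real" where
  "nonface_count E \<Lambda> i = real (card {A. A \<subseteq> E \<and> A \<notin> \<Lambda> \<and> card A = i})"

lemma card_supersets_of_size:
  assumes "finite E" and "A \<subseteq> E" and "card A \<le> k"
  shows "card {C. A \<subseteq> C \<and> C \<subseteq> E \<and> card C = k} = (card E - card A) choose (k - card A)"
proof -
  have finA: "finite A"
    using assms finite_subset by blast
  let ?D = "{D. D \<subseteq> E - A \<and> card D = k - card A}"
  have "bij_betw (\<lambda>D. A \<union> D) ?D {C. A \<subseteq> C \<and> C \<subseteq> E \<and> card C = k}"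
  proof (rule bij_betw_byWitness[where f' = "\<lambda>C. C - A"])
    show "(\<lambda>D. A \<union> D) ` ?D \<subseteq> {C. A \<subseteq> C \<and> C \<subseteq> E \<and> card C = k}"
    proof (intro image_subsetI)
      fix D assume D: "D \<in> ?D"
      then have "finite D" "A \<inter> D = {}"
        using assms(1) finite_subset by auto
      then show "A \<union> D \<in> {C. A \<subseteq> C \<and> C \<subseteq> E \<and> card C = k}"
        using D assms finA by (auto simp: card_Un_disjoint)
    qed
    show "(\<lambda>C. C - A) ` {C. A \<subseteq> C \<and> C \<subseteq> E \<and> card C = k} \<subseteq> ?D"
      using finA by (auto simp: card_Diff_subset)
  qed auto
  then have "card {C. A \<subseteq> C \<and> C \<subseteq> E \<and> card C = k} = card ?D"
    by (simp add: bij_betw_same_card)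
  also have "\<dots> = card (E - A) choose (k - card A)"
    using assms(1) by (intro n_subsets) simp
  also have "card (E - A) = card E - card A"
    using finA assms(2) by (rule card_Diff_subset)
  finally show ?thesis .
qed

text \<open>The hypothesis \<open>euler\<close> gives \<open>\<Sum> (-1)\<^bsup>card A\<^esup> = -1\<close> for the non-faces \<open>A\<close> inside a non-face \<open>C\<close>;
  this is summed over all \<open>C\<close> of size \<open>k\<close>.\<close>

lemma nonface_count_relation:
  assumes fin: "finite E" and empty: "{} \<in> \<Lambda>"
    and down: "\<And>A B. B \<in> \<Lambda> \<Longrightarrow> A \<subseteq> B \<Longrightarrow> A \<in> \<Lambda>"
    and euler: "\<And>C. C \<subseteq> E \<Longrightarrow> C \<notin> \<Lambda> \<Longrightarrow> (\<Sum>A | A \<subseteq> C \<and> A \<in> \<Lambda>. (- 1 :: real) ^ card A) = 1"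
  shows "(\<Sum>i\<le>k. (- 1) ^ i * nonface_count E \<Lambda> i * real ((card E - i) choose (k - i)))
    = - nonface_count E \<Lambda> k"
proof -
  define N where "N = {A. A \<subseteq> E \<and> A \<notin> \<Lambda>}"
  define K where "K = {C. C \<subseteq> E \<and> card C = k}"
  have finN: "finite N" and finK: "finite K"
    using fin by (simp_all add: N_def K_def)
  have inner: "(\<Sum>A | A \<in> N \<and> A \<subseteq> C. (- 1 :: real) ^ card A) = (if C \<in> \<Lambda> then 0 else - 1)"
    if "C \<in> K" for C
  proof (cases "C \<in> \<Lambda>")
    case True
    then have none: "{A. A \<in> N \<and> A \<subseteq> C} = {}"
      using down by (auto simp: N_def)
    show ?thesis
      unfolding none using True by simp
  next
    case False
    have C: "C \<subseteq> E" "finite C" "C \<noteq> {}"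
      using that fin finite_subset False empty by (auto simp: K_def)
    have "Pow C = {A. A \<subseteq> C \<and> A \<in> \<Lambda>} \<union> {A. A \<in> N \<and> A \<subseteq> C}"
      using C by (auto simp: N_def)
    then have "(\<Sum>A\<in>Pow C. (- 1 :: real) ^ card A)
      = (\<Sum>A | A \<subseteq> C \<and> A \<in> \<Lambda>. (- 1) ^ card A) + (\<Sum>A | A \<in> N \<and> A \<subseteq> C. (- 1) ^ card A)"
      using C finN by (simp add: sum.union_disjoint N_def disjoint_iff)
    then show ?thesis
      using euler[OF C(1) False] sum_alternating_Pow[OF C(2,3)] False by simp
  qed
  have "- nonface_count E \<Lambda> k = (\<Sum>C\<in>K. if C \<in> \<Lambda> then 0 else - 1)"
  proof -
    have "{C \<in> K. C \<notin> \<Lambda>} = {A. A \<subseteq> E \<and> A \<notin> \<Lambda> \<and> card A = k}"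
      by (auto simp: K_def)
    then have "nonface_count E \<Lambda> k = (\<Sum>C\<in>K. if C \<notin> \<Lambda> then 1 else 0)"
      using finK by (simp add: nonface_count_def flip: sum.inter_filter)
    then show ?thesis
      by (simp add: if_distrib flip: sum_negf cong: if_cong) (rule sum.cong, auto)
  qed
  also have "\<dots> = (\<Sum>C\<in>K. \<Sum>A | A \<in> N \<and> A \<subseteq> C. (- 1) ^ card A)"
    using inner by simp
  also have "\<dots> = (\<Sum>A\<in>N. \<Sum>C | C \<in> K \<and> A \<subseteq> C. (- 1) ^ card A)"
    by (rule sum.swap_restrict[OF finK finN])
  also have "\<dots> = (\<Sum>A\<in>N. if card A \<le> k
      then (- 1) ^ card A * real ((card E - card A) choose (k - card A)) else 0)"
  proof (rule sum.cong[OF refl])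
    fix A assume "A \<in> N"
    have eq: "{C. C \<in> K \<and> A \<subseteq> C} = {C. A \<subseteq> C \<and> C \<subseteq> E \<and> card C = k}"
      by (auto simp: K_def)
    have none: "{C. A \<subseteq> C \<and> C \<subseteq> E \<and> card C = k} = {}" if "\<not> card A \<le> k"
      using that fin card_mono finite_subset by (metis (mono_tags, lifting) empty_Collect_eq)
    show "(\<Sum>C | C \<in> K \<and> A \<subseteq> C. (- 1) ^ card A) = (if card A \<le> k
        then (- 1) ^ card A * real ((card E - card A) choose (k - card A)) else 0)"
    proof (cases "card A \<le> k")
      case True
      then show ?thesis
        using \<open>A \<in> N\<close> card_supersets_of_size[OF fin, of A k] by (simp add: eq N_def)
    qed (simp add: eq none)
  qed
  also have "\<dots> = (\<Sum>A | A \<in> N \<and> card A \<le> k.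
      (- 1) ^ card A * real ((card E - card A) choose (k - card A)))"
    using finN by (simp add: sum.inter_filter)
  also have "\<dots> = (\<Sum>i\<le>k. \<Sum>A | A \<in> {A. A \<in> N \<and> card A \<le> k} \<and> card A = i.
      (- 1) ^ card A * real ((card E - card A) choose (k - card A)))"
    using finN by (intro sum.group[symmetric]) auto
  also have "\<dots> = (\<Sum>i\<le>k. (- 1) ^ i * nonface_count E \<Lambda> i * real ((card E - i) choose (k - i)))"
  proof (rule sum.cong[OF refl])
    fix i assume "i \<in> {..k}"
    then have "{A. A \<in> {A. A \<in> N \<and> card A \<le> k} \<and> card A = i}
        = {A. A \<subseteq> E \<and> A \<notin> \<Lambda> \<and> card A = i}"
      by (auto simp: N_def)
    then show "(\<Sum>A | A \<in> {A. A \<in> N \<and> card A \<le> k} \<and> card A = i.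
        (- 1) ^ card A * real ((card E - card A) choose (k - card A)))
      = (- 1) ^ i * nonface_count E \<Lambda> i * real ((card E - i) choose (k - i))"
      by (simp add: nonface_count_def)
  qed
  finally show ?thesis
    by simp
qed

text \<open>The sequence \<open>v\<close> moved up by \<open>d\<close> places, with zeros in the first \<open>d\<close> places.\<close>

definition shift_seq :: "nat \<Rightarrow> (nat \<Rightarrow> real) \<Rightarrow> nat \<Rightarrow> real" where
  "shift_seq d v j = (if d \<le> j then v (j - d) else 0)"

lemma shift_seq_relation:
  assumes rel: "\<And>k. (\<Sum>i\<le>k. (- 1) ^ i * v i * real ((s - i) choose (k - i))) = - v k"
    and "odd d"
  shows "(\<Sum>i\<le>k. (- 1) ^ i * shift_seq d v i * real ((s + d - i) choose (k - i))) = shift_seq d v k"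
proof (cases "d \<le> k")
  case True
  have "(\<Sum>i\<le>k. (- 1) ^ i * shift_seq d v i * real ((s + d - i) choose (k - i)))
      = (\<Sum>i=d..k. (- 1) ^ i * v (i - d) * real ((s + d - i) choose (k - i)))"
    by (rule sum.mono_neutral_cong_right) (auto simp: shift_seq_def)
  also have "\<dots> = (\<Sum>i\<le>k - d. (- 1) ^ (i + d) * v i * real ((s - i) choose (k - d - i)))"
    by (rule sum.reindex_bij_witness[of _ "\<lambda>i. i + d" "\<lambda>i. i - d"]) (use True in \<open>auto simp: diff_commute\<close>)
  also have "\<dots> = - (\<Sum>i\<le>k - d. (- 1) ^ i * v i * real ((s - i) choose (k - d - i)))"
    using \<open>odd d\<close> by (simp add: power_add sum_negf)
  finally show ?thesis
    using rel[of "k - d"] True by (simp add: shift_seq_def)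
qed (simp add: shift_seq_def)

section \<open>Symmetry of the binomial transform\<close>

lemma alternating_binomial_difference:
  fixes f :: "nat \<Rightarrow> real"
  shows "(\<Sum>p\<le>Suc n. (- 1) ^ p * real (Suc n choose p) * f p)
    = (\<Sum>p\<le>n. (- 1) ^ p * real (n choose p) * (f p - f (Suc p)))"
proof -
  have "(\<Sum>p\<le>Suc n. (- 1) ^ p * real (Suc n choose p) * f p)
      = f 0 + (\<Sum>p\<le>n. (- 1) ^ Suc p * real (n choose Suc p) * f (Suc p))
        - (\<Sum>p\<le>n. (- 1) ^ p * real (n choose p) * f (Suc p))"
    by (subst sum.atMost_Suc_shift)
      (simp add: algebra_simps sum.distrib sum_negf sum_subtractf)
  also have "f 0 + (\<Sum>p\<le>n. (- 1) ^ Suc p * real (n choose Suc p) * f (Suc p))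
      = (\<Sum>p\<le>Suc n. (- 1) ^ p * real (n choose p) * f p)"
    by (subst sum.atMost_Suc_shift) simp
  also have "\<dots> = (\<Sum>p\<le>n. (- 1) ^ p * real (n choose p) * f p)"
    by simp
  finally show ?thesis
    by (simp add: algebra_simps sum_subtractf)
qed

text \<open>Up to sign, this is the \<open>n\<close>-th finite difference of the polynomial \<open>x choose l\<close> at \<open>x = i\<close>.\<close>

lemma alternating_binomial_convolution:
  "(\<Sum>p\<le>n. (- 1) ^ p * real (n choose p) * real ((i + p) choose l))
    = (if n \<le> l then (- 1) ^ n * real (i choose (l - n)) else 0)"
proof (induction n arbitrary: l)
  case (Suc n)
  show ?case
  proof (cases l)
    case 0
    then show ?thesis
      by (simp only: alternating_binomial_difference) simp
  next
    case (Suc l')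
    have "(\<Sum>p\<le>Suc n. (- 1) ^ p * real (Suc n choose p) * real ((i + p) choose l))
        = - (\<Sum>p\<le>n. (- 1) ^ p * real (n choose p) * real ((i + p) choose l'))"
      by (simp only: alternating_binomial_difference) (simp add: Suc sum_negf)
    then show ?thesis
      using Suc.IH[of l'] Suc by simp
  qed
qed simp

text \<open>The coefficient of \<open>x\<^sup>l\<close> in \<open>\<Sum>\<^sub>k v\<^sub>k (x - 1)\<^sup>k\<close>, where \<open>k \<le> t\<close>. The vector \<open>v U S\<close> lists these
  coefficients in reverse order.\<close>

definition signed_binomial_transform :: "nat \<Rightarrow> (nat \<Rightarrow> real) \<Rightarrow> nat \<Rightarrow> real" where
  "signed_binomial_transform t v l = (\<Sum>k\<le>t. (- 1) ^ (k + l) * real (k choose l) * v k)"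

text \<open>The left-hand side of the relations is an involution on vectors; its eigenvectors for the
  eigenvalues \<open>1\<close> and \<open>- 1\<close> have symmetric and antisymmetric transforms.\<close>

lemma signed_binomial_transform_reverse:
  assumes rel: "\<And>k. k \<le> t \<Longrightarrow> (\<Sum>i\<le>k. (- 1) ^ i * v i * real ((t - i) choose (k - i))) = \<epsilon> * v k"
    and "l \<le> t"
  shows "signed_binomial_transform t v (t - l) = \<epsilon> * signed_binomial_transform t v l"
proof -
  have "\<epsilon> * signed_binomial_transform t v l
      = (\<Sum>k\<le>t. (- 1) ^ (k + l) * real (k choose l) * (\<epsilon> * v k))"
    unfolding signed_binomial_transform_def sum_distrib_left
    by (intro sum.cong refl) (simp only: mult_ac)
  also have "\<dots> = (\<Sum>k\<le>t. \<Sum>i | i \<in> {..t} \<and> i \<le> k. (- 1) ^ (k + l) * real (k choose l) *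
        ((- 1) ^ i * v i * real ((t - i) choose (k - i))))"
  proof (rule sum.cong[OF refl])
    fix k assume "k \<in> {..t}"
    then have "{i. i \<in> {..t} \<and> i \<le> k} = {..k}" "k \<le> t"
      by auto
    then show "(- 1) ^ (k + l) * real (k choose l) * (\<epsilon> * v k) =
      (\<Sum>i | i \<in> {..t} \<and> i \<le> k. (- 1) ^ (k + l) * real (k choose l) *
        ((- 1) ^ i * v i * real ((t - i) choose (k - i))))"
      by (simp only: rel[symmetric] sum_distrib_left)
  qed
  also have "\<dots> = (\<Sum>i\<le>t. \<Sum>k | k \<in> {..t} \<and> i \<le> k. (- 1) ^ (k + l) * real (k choose l) *
        ((- 1) ^ i * v i * real ((t - i) choose (k - i))))"
    by (rule sum.swap_restrict) auto
  also have "\<dots> = (\<Sum>i\<le>t. (- 1) ^ (i + (t - l)) * real (i choose (t - l)) * v i)"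
  proof (rule sum.cong[OF refl])
    fix i assume "i \<in> {..t}"
    then have i: "i \<le> t" by simp
    have "(\<Sum>k | k \<in> {..t} \<and> i \<le> k. (- 1) ^ (k + l) * real (k choose l) *
        ((- 1) ^ i * v i * real ((t - i) choose (k - i))))
      = (\<Sum>p\<le>t - i. (- 1) ^ (i + p + l) * real ((i + p) choose l) *
        ((- 1) ^ i * v i * real ((t - i) choose p)))"
      by (rule sum.reindex_bij_witness[of _ "\<lambda>p. i + p" "\<lambda>k. k - i"]) (use i in auto)
    also have "\<dots> = (- 1) ^ l * v i *
        (\<Sum>p\<le>t - i. (- 1) ^ p * real ((t - i) choose p) * real ((i + p) choose l))"
      unfolding sum_distrib_left
    proof (rule sum.cong[OF refl])
      fix p
      have sign: "(- 1 :: real) ^ (i + p + l) * (- 1) ^ i = (- 1) ^ l * (- 1) ^ p"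
        by (simp add: minus_one_power_iff)
      have "(- 1) ^ (i + p + l) * real ((i + p) choose l) *
          ((- 1) ^ i * v i * real ((t - i) choose p))
        = ((- 1) ^ (i + p + l) * (- 1) ^ i) * (v i * real ((t - i) choose p) * real ((i + p) choose l))"
        by (simp only: mult_ac)
      then show "(- 1) ^ (i + p + l) * real ((i + p) choose l) *
          ((- 1) ^ i * v i * real ((t - i) choose p))
        = (- 1) ^ l * v i * ((- 1) ^ p * real ((t - i) choose p) * real ((i + p) choose l))"
        unfolding sign by (simp only: mult_ac)
    qed
    also have "\<dots> = (- 1) ^ (i + (t - l)) * real (i choose (t - l)) * v i"
    proof (cases "t - i \<le> l")
      case True
      have "i choose (l - (t - i)) = i choose (t - l)"
        using True i \<open>l \<le> t\<close> binomial_symmetric[of "t - l" i]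
        by (simp add: algebra_simps)
      then have "(- 1) ^ l * v i *
          (\<Sum>p\<le>t - i. (- 1) ^ p * real ((t - i) choose p) * real ((i + p) choose l))
        = ((- 1) ^ l * (- 1) ^ (t - i)) * (real (i choose (t - l)) * v i)"
        unfolding alternating_binomial_convolution using True by (simp add: mult_ac)
      also have "(- 1 :: real) ^ l * (- 1) ^ (t - i) = (- 1) ^ (i + (t - l))"
        using i \<open>l \<le> t\<close> by (simp add: minus_one_power_iff)
      finally show ?thesis
        by (simp only: mult_ac)
    next
      case False
      then show ?thesis
        using i by (simp add: alternating_binomial_convolution binomial_eq_0)
    qed
    finally show "(\<Sum>k | k \<in> {..t} \<and> i \<le> k. (- 1) ^ (k + l) * real (k choose l) *
        ((- 1) ^ i * v i * real ((t - i) choose (k - i))))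
      = (- 1) ^ (i + (t - l)) * real (i choose (t - l)) * v i" .
  qed
  finally show ?thesis
    by (simp add: signed_binomial_transform_def)
qed

lemma signed_binomial_transform_orthogonal:
  assumes v: "\<And>k. k \<le> t \<Longrightarrow> (\<Sum>i\<le>k. (- 1) ^ i * v i * real ((t - i) choose (k - i))) = v k"
    and w: "\<And>k. k \<le> t \<Longrightarrow> (\<Sum>i\<le>k. (- 1) ^ i * w i * real ((t - i) choose (k - i))) = - w k"
  shows "(\<Sum>l\<le>t. signed_binomial_transform t v l * signed_binomial_transform t w l) = 0"
proof -
  let ?S = "\<Sum>l\<le>t. signed_binomial_transform t v l * signed_binomial_transform t w l"
  have "?S = (\<Sum>l\<le>t. signed_binomial_transform t v (t - l) * signed_binomial_transform t w (t - l))"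
    by (rule sum.nat_diff_reindex[symmetric, of _ "Suc t", unfolded lessThan_Suc_atMost, simplified])
  also have "\<dots> = - ?S"
    using signed_binomial_transform_reverse[of t v 1] signed_binomial_transform_reverse[of t w "- 1"] v w
    by (simp add: sum_negf)
  finally show ?thesis
    by simp
qed

section \<open>Matrix products\<close>

text \<open>The first \<open>t + 1\<close> terms of a sequence as a matrix with a single row.\<close>

definition row_vector :: "nat \<Rightarrow> (nat \<Rightarrow> real) \<Rightarrow> real mat" where
  "row_vector t v = mat 1 (t + 1) (\<lambda>(_, j). v j)"

lemma row_vector_carrier [simp]: "row_vector t v \<in> carrier_mat 1 (t + 1)"
  by (simp add: row_vector_def)

lemma row_vector_mult:
  assumes "A \<in> carrier_mat (t + 1) (t + 1)"
  shows "row_vector t v * A = row_vector t (\<lambda>j. \<Sum>i\<le>t. v i * A $$ (i, j))"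
proof (rule eq_matI)
  fix i j assume "i < dim_row (row_vector t (\<lambda>j. \<Sum>i\<le>t. v i * A $$ (i, j)))"
    and "j < dim_col (row_vector t (\<lambda>j. \<Sum>i\<le>t. v i * A $$ (i, j)))"
  then show "(row_vector t v * A) $$ (i, j) = row_vector t (\<lambda>j. \<Sum>i\<le>t. v i * A $$ (i, j)) $$ (i, j)"
    using assms
    by (auto simp: row_vector_def scalar_prod_def atLeast0LessThan lessThan_Suc_atMost intro!: sum.cong)
qed (use assms in \<open>auto simp: row_vector_def\<close>)

lemma row_vector_cong:
  "(\<And>j. j \<le> t \<Longrightarrow> v j = w j) \<Longrightarrow> row_vector t v = row_vector t w"
  by (auto simp: row_vector_def)

lemma row_vector_mult_forward_shift_pow:
  "row_vector t v * forward_shift t ^\<^sub>m d = row_vector t (shift_seq d v)"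
proof (induction d)
  case 0
  have "dim_row (forward_shift t) = t + 1"
    by (simp add: forward_shift_def)
  then show ?case
    by (simp only: pow_mat.simps(1) right_mult_one_mat[OF row_vector_carrier])
      (simp add: shift_seq_def[abs_def])
next
  case (Suc d)
  have F: "forward_shift t \<in> carrier_mat (t + 1) (t + 1)"
    by (simp add: forward_shift_def)
  have "row_vector t v * forward_shift t ^\<^sub>m Suc d
      = row_vector t v * forward_shift t ^\<^sub>m d * forward_shift t"
    using F by (simp add: assoc_mult_mat[OF row_vector_carrier pow_carrier_mat[OF F] F])
  also have "\<dots> = row_vector t (shift_seq d v) * forward_shift t"
    by (simp only: Suc)
  also have "\<dots> = row_vector t (shift_seq (Suc d) v)"
    unfolding row_vector_mult[OF F]
  proof (rule row_vector_cong)
    fix j assume "j \<le> t"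
    have "(\<Sum>i\<le>t. shift_seq d v i * forward_shift t $$ (i, j))
        = (\<Sum>i\<le>t. if j = i + 1 then shift_seq d v i else 0)"
      using \<open>j \<le> t\<close> by (intro sum.cong refl) (auto simp: forward_shift_def)
    also have "\<dots> = shift_seq (Suc d) v j"
      using \<open>j \<le> t\<close> by (cases j) (auto simp: shift_seq_def)
    finally show "(\<Sum>i\<le>t. shift_seq d v i * forward_shift t $$ (i, j)) = shift_seq (Suc d) v j" .
  qed
  finally show ?case .
qed

lemma row_vector_mult_backward_identity:
  "row_vector t v * backward_identity t = row_vector t (\<lambda>j. v (t - j))"
proof -
  have U: "backward_identity t \<in> carrier_mat (t + 1) (t + 1)"
    by (simp add: backward_identity_def)
  show ?thesis
    unfolding row_vector_mult[OF U]
  proof (rule row_vector_cong)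
    fix j assume "j \<le> t"
    then have "(\<Sum>i\<le>t. v i * backward_identity t $$ (i, j)) = (\<Sum>i\<le>t. if i = t - j then v i else 0)"
      by (intro sum.cong refl) (auto simp: backward_identity_def)
    then show "(\<Sum>i\<le>t. v i * backward_identity t $$ (i, j)) = v (t - j)"
      by simp
  qed
qed

lemma row_vector_mult_backward_identity_S_mat:
  "row_vector t v * backward_identity t * S_mat t
    = row_vector t (\<lambda>j. signed_binomial_transform t v (t - j))"
proof -
  have S: "S_mat t \<in> carrier_mat (t + 1) (t + 1)"
    by (simp add: S_mat_def)
  show ?thesis
    unfolding row_vector_mult_backward_identity row_vector_mult[OF S]
  proof (rule row_vector_cong)
    fix j assume j: "j \<le> t"
    have "(\<Sum>i\<le>t. v (t - i) * S_mat t $$ (i, j)) = (\<Sum>k\<le>t. v k * S_mat t $$ (t - k, j))"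
      by (rule sum.reindex_bij_witness[of _ "\<lambda>k. t - k" "\<lambda>k. t - k"]) auto
    also have "\<dots> = signed_binomial_transform t v (t - j)"
      unfolding signed_binomial_transform_def
    proof (rule sum.cong[OF refl])
      fix k assume "k \<in> {..t}"
      then have k: "k \<le> t" by simp
      show "v k * S_mat t $$ (t - k, j) = (- 1) ^ (k + (t - j)) * real (k choose (t - j)) * v k"
      proof (cases "t - k \<le> j")
        case True
        have "k choose (j - (t - k)) = k choose (t - j)"
          using True k j binomial_symmetric[of "t - j" k] by (simp add: algebra_simps)
        moreover have "(- 1 :: real) ^ (k + (t - j)) = (- 1) ^ (j - (t - k))"
        proof -
          have eq: "k + (t - j) = (j - (t - k)) + 2 * (t - j)"
            using True k j by simp
          show ?thesis
            unfolding eq by (simp add: power_add)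
        qed
        ultimately show ?thesis
          using True k j by (simp add: S_mat_def)
      next
        case False
        then show ?thesis
          using k j by (simp add: S_mat_def binomial_eq_0)
      qed
    qed
    finally show "(\<Sum>i\<le>t. v (t - i) * S_mat t $$ (i, j)) = signed_binomial_transform t v (t - j)" .
  qed
qed

lemma row_vector_M_mat_bilinear:
  "row_vector t v * M_mat t * transpose_mat (row_vector t w)
    = mat 1 1 (\<lambda>_. \<Sum>l\<le>t. signed_binomial_transform t v l * signed_binomial_transform t w l)"
proof -
  let ?n = "t + 1"
  define U where "U = backward_identity t"
  define S where "S = S_mat t"
  define x where "x = row_vector t v"
  define y where "y = row_vector t w"
  have c: "U \<in> carrier_mat ?n ?n" "S \<in> carrier_mat ?n ?n" "S\<^sup>T \<in> carrier_mat ?n ?n"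
    "x \<in> carrier_mat 1 ?n" "y \<in> carrier_mat 1 ?n" "y\<^sup>T \<in> carrier_mat ?n 1"
    by (simp_all add: U_def S_def x_def y_def backward_identity_def S_mat_def row_vector_def)
  have UT: "U\<^sup>T = U"
    by (auto simp: U_def backward_identity_def add.commute)
  have "x * M_mat t * y\<^sup>T = x * (U * S * S\<^sup>T * U) * y\<^sup>T"
    by (simp add: M_mat_def U_def S_def)
  also have "\<dots> = x * (U * (S * (S\<^sup>T * (U * y\<^sup>T))))"
    using c by (simp only: assoc_mult_mat[of _ 1 ?n _ ?n _ 1] assoc_mult_mat[of _ ?n ?n _ ?n _ 1]
      mult_carrier_mat[of _ ?n ?n _ ?n] mult_carrier_mat[of _ ?n ?n _ 1])
  also have "\<dots> = (x * U * S) * (S\<^sup>T * (U * y\<^sup>T))"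
    using c by (simp only: assoc_mult_mat[of _ 1 ?n _ ?n _ 1]
      mult_carrier_mat[of _ 1 ?n _ ?n] mult_carrier_mat[of _ ?n ?n _ 1])
  also have "S\<^sup>T * (U * y\<^sup>T) = (y * U * S)\<^sup>T"
    using c by (simp only: transpose_mult[of _ 1 ?n _ ?n] mult_carrier_mat[of _ 1 ?n _ ?n] UT)
  also have "(x * U * S) * (y * U * S)\<^sup>T
    = mat 1 1 (\<lambda>_. \<Sum>j\<le>t. signed_binomial_transform t v (t - j) * signed_binomial_transform t w (t - j))"
    unfolding x_def y_def U_def S_def row_vector_mult_backward_identity_S_mat
    by (rule eq_matI) (auto simp: row_vector_def scalar_prod_def atLeast0LessThan lessThan_Suc_atMost intro!: sum.cong)
  also have "(\<Sum>j\<le>t. signed_binomial_transform t v (t - j) * signed_binomial_transform t w (t - j))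
    = (\<Sum>l\<le>t. signed_binomial_transform t v l * signed_binomial_transform t w l)"
    by (rule sum.reindex_bij_witness[of _ "\<lambda>k. t - k" "\<lambda>k. t - k"]) auto
  finally show ?thesis
    by (simp add: x_def y_def)
qed

section \<open>The complexes of two topes\<close>

lemma complex_nonface_count_relation:
  assumes M: "simple_oriented_matroid E L" and "E \<noteq> {}"
    and R: "symmetric_cycle E L R" and T: "T \<in> topes L"
    and \<Q>: "\<Q> \<subseteq> cycle_verts R" and sum: "sums_to \<Q> T"
    and \<Lambda>: "\<Lambda> = complex_of_facets {E - sep E T Q | Q. Q \<in> \<Q>}"
  shows "(\<Sum>i\<le>k. (- 1) ^ i * nonface_count E \<Lambda> i * real ((card E - i) choose (k - i)))
    = - nonface_count E \<Lambda> k"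
proof -
  interpret simple_oriented_matroid E L
    by (rule M)
  let ?F = "{E - sep E T Q | Q. Q \<in> \<Q>}"
  obtain pos :: "_ \<Rightarrow> nat" and X where pos: "inj_on pos E" and X_sign: "\<forall>e\<in>E. X e \<in> {1, - 1}"
    and all_form: "\<forall>Q\<in>cycle_verts R.
      \<exists>j. \<exists>c\<in>{1, - 1}. \<forall>e\<in>E. Q e = c * (if j \<le> pos e then X e else - X e)"
    by (rule symmetric_cycle_normal_form[OF R \<open>E \<noteq> {}\<close>])
  note X = bspec[OF X_sign]
  have T_sign: "T e \<in> {1, - 1}" if "e \<in> E" for e
    using tope_sign[OF T that] .
  have Q_sign: "Q e \<in> {1, - 1}" if Q: "Q \<in> \<Q>" and e: "e \<in> E" for Q e
  proof -
    obtain j c where c: "c \<in> {1, - 1}" and "Q e = c * (if j \<le> pos e then X e else - X e)"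
      using bspec[OF all_form subsetD[OF \<Q> Q]] e by blast
    then show ?thesis
      using X[OF e] by (auto split: if_splits)
  qed
  have T_sum: "T e = (\<Sum>Q\<in>\<Q>. Q e)" for e
    using sum by (auto simp: sums_to_def)
  have "\<Q> \<noteq> {}"
  proof
    assume "\<Q> = {}"
    then have "T e = 0" for e
      using T_sum[of e] by simp
    moreover obtain e where "e \<in> E"
      using \<open>E \<noteq> {}\<close> by blast
    ultimately show False
      using T_sign[of e] by simp
  qed
  \<comment> \<open>At two elements \<open>a\<close> and \<open>b\<close>, the signs of agreement of the \<open>Q\<close> with \<open>T\<close> add up to \<open>1\<close> each, so some
    \<open>Q\<close> agrees with \<open>T\<close> at both.\<close>
  have pairs: "\<exists>F\<in>?F. a \<in> F \<and> b \<in> F" if "a \<in> E" "b \<in> E" for a b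
  proof -
    have "(\<Sum>Q\<in>\<Q>. Q a * T a + Q b * T b) = T a * T a + T b * T b"
      by (simp only: sum.distrib flip: sum_distrib_right T_sum)
    also have "\<dots> > 0"
      using T_sign[OF that(1)] T_sign[OF that(2)] by auto
    finally obtain Q where Q: "Q \<in> \<Q>" "0 < Q a * T a + Q b * T b"
      using sum_nonpos[of \<Q> "\<lambda>Q. Q a * T a + Q b * T b"] by (meson not_le)
    then have "Q a = T a" "Q b = T b"
      using T_sign[OF that(1)] T_sign[OF that(2)] Q_sign[OF Q(1) that(1)] Q_sign[OF Q(1) that(2)]
      by auto
    then show ?thesis
      using Q(1) that by (intro bexI[of _ "E - sep E T Q"]) (auto simp: sep_def)
  qed
  have facets: "\<exists>j \<sigma>. F = E \<inter> agreement_set pos (\<lambda>e. X e = T e) j \<sigma>" if "F \<in> ?F" for F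
  proof -
    from that obtain Q where Q: "Q \<in> \<Q>" "F = E - sep E T Q"
      by blast
    obtain j c where c: "c \<in> {1, - 1}"
      and eq: "\<forall>e\<in>E. Q e = c * (if j \<le> pos e then X e else - X e)"
      using bspec[OF all_form subsetD[OF \<Q> Q(1)]] by (elim exE bexE)
    have "T e = Q e \<longleftrightarrow> e \<in> agreement_set pos (\<lambda>e. X e = T e) j (c = 1)" if "e \<in> E" for e
    proof -
      have "Q e = c * (if j \<le> pos e then X e else - X e)"
        using eq that by (rule bspec)
      moreover have "c = 1 \<or> c = - 1" "X e = 1 \<or> X e = - 1" "T e = 1 \<or> T e = - 1"
        using c X[OF that] T_sign[OF that] by simp_all
      ultimately show ?thesis
        by (cases "j \<le> pos e") (elim disjE; simp add: agreement_set_def)+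
    qed
    then have "F = E \<inter> agreement_set pos (\<lambda>e. X e = T e) j (c = 1)"
      unfolding Q(2) by (auto simp: sep_def)
    then show ?thesis
      by blast
  qed
  have "?F \<noteq> {}"
    using \<open>\<Q> \<noteq> {}\<close> by auto
  show ?thesis
  proof (rule nonface_count_relation[OF finite_ground])
    show "{} \<in> \<Lambda>"
      using \<open>?F \<noteq> {}\<close> unfolding \<Lambda> complex_of_facets_def by blast
    show "A \<in> \<Lambda>" if "B \<in> \<Lambda>" "A \<subseteq> B" for A B
      using that unfolding \<Lambda> complex_of_facets_def by blast
    show "(\<Sum>A | A \<subseteq> C \<and> A \<in> \<Lambda>. (- 1 :: real) ^ card A) = 1" if "C \<subseteq> E" "C \<notin> \<Lambda>" for C
      unfolding \<Lambda> by (rule agreement_complex_alternating_sum[OF finite_ground pos facets pairs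
        \<open>?F \<noteq> {}\<close> that(1) that(2)[unfolded \<Lambda>]])
  qed
qed

lemma binom_minus_f_vector:
  assumes "\<Lambda> \<subseteq> Pow {1..n}"
  shows "binom_vector n t - long_f_vector \<Lambda> t = row_vector t (nonface_count {1..n} \<Lambda>)"
proof -
  have "real (n choose j) - real (card {F \<in> \<Lambda>. card F = j}) = nonface_count {1..n} \<Lambda> j" for j
  proof -
    let ?A = "{A. A \<subseteq> {1..n} \<and> card A = j}"
    have "n choose j = card ?A"
      using n_subsets[of "{1..n}" j] by simp
    moreover have "{F \<in> \<Lambda>. card F = j} \<subseteq> ?A"
      using assms by auto
    moreover have "{A. A \<subseteq> {1..n} \<and> A \<notin> \<Lambda> \<and> card A = j} = ?A - {F \<in> \<Lambda>. card F = j}"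
      by auto
    ultimately show ?thesis
      by (simp add: nonface_count_def card_Diff_subset finite_subset card_mono of_nat_diff)
  qed
  then show ?thesis
    by (auto simp: binom_vector_def long_f_vector_def row_vector_def)
qed

theorem proposition2p1:
  fixes s t :: nat
    and L' L'' :: "nat covector set"
    and R' R'' :: "(nat covector \<times> nat covector) list"
    and T' T'' :: "nat covector"
    and \<Q>' \<Q>'' :: "nat covector set"
    and \<Lambda>' \<Lambda>'' :: "nat set set"
  assumes "0 < s" and "s < t" and "s mod 2 \<noteq> t mod 2"
    and "simple_oriented_matroid {1..s} L'"
    and "simple_oriented_matroid {1..t} L''"
    and "symmetric_cycle {1..s} L' R'"
    and "symmetric_cycle {1..t} L'' R''"
    and "T' \<in> topes L'"
    and "T'' \<in> topes L''"
    and "minimal_decomposition T' (cycle_verts R') \<Q>'"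
    and "minimal_decomposition T'' (cycle_verts R'') \<Q>''"
    and "card \<Q>' \<ge> 5"
    and "card \<Q>'' \<ge> 5"
    and "\<Lambda>' = complex_of_facets {{1..s} - sep {1..s} T' Q' | Q'. Q' \<in> \<Q>'}"
    and "\<Lambda>'' = complex_of_facets {{1..t} - sep {1..t} T'' Q'' | Q''. Q'' \<in> \<Q>''}"
  shows "(binom_vector s t - long_f_vector \<Lambda>' t) * forward_shift t ^\<^sub>m (t - s) * M_mat t *
      (transpose_mat (binom_vector t t) - transpose_mat (long_f_vector \<Lambda>'' t)) = 0\<^sub>m 1 1"
proof -
  let ?g' = "nonface_count {1..s} \<Lambda>'" and ?g'' = "nonface_count {1..t} \<Lambda>''"
  have rel': "(\<Sum>i\<le>k. (- 1) ^ i * ?g' i * real ((s - i) choose (k - i))) = - ?g' k" for k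
    using complex_nonface_count_relation[OF assms(4) _ assms(6,8) _ _ assms(14), of k] assms(1,10)
    by (simp add: minimal_decomposition_def)
  have rel'': "(\<Sum>i\<le>k. (- 1) ^ i * ?g'' i * real ((t - i) choose (k - i))) = - ?g'' k" for k
    using complex_nonface_count_relation[OF assms(5) _ assms(7,9) _ _ assms(15), of k] assms(1,2,11)
    by (simp add: minimal_decomposition_def)
  have "odd (t - s)"
    using assms(2,3) by (simp add: mod2_eq_if split: if_splits)
  then have shifted: "(\<Sum>i\<le>k. (- 1) ^ i * shift_seq (t - s) ?g' i * real ((t - i) choose (k - i)))
      = shift_seq (t - s) ?g' k" for k
    using shift_seq_relation[OF rel', of "t - s" k] assms(2) by simp
  have vec': "binom_vector s t - long_f_vector \<Lambda>' t = row_vector t ?g'"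
    using assms(14) by (intro binom_minus_f_vector) (auto simp: complex_of_facets_def)
  have vec'': "binom_vector t t - long_f_vector \<Lambda>'' t = row_vector t ?g''"
    using assms(15) by (intro binom_minus_f_vector) (auto simp: complex_of_facets_def)
  have "transpose_mat (binom_vector t t) - transpose_mat (long_f_vector \<Lambda>'' t)
      = transpose_mat (binom_vector t t - long_f_vector \<Lambda>'' t)"
    by (auto simp: binom_vector_def long_f_vector_def)
  then have "(binom_vector s t - long_f_vector \<Lambda>' t) * forward_shift t ^\<^sub>m (t - s) * M_mat t *
      (transpose_mat (binom_vector t t) - transpose_mat (long_f_vector \<Lambda>'' t))
    = row_vector t (shift_seq (t - s) ?g') * M_mat t * transpose_mat (row_vector t ?g'')"
    by (simp only: vec' vec'' row_vector_mult_forward_shift_pow)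
  also have "\<dots> = 0\<^sub>m 1 1"
    unfolding row_vector_M_mat_bilinear signed_binomial_transform_orthogonal[OF shifted rel'']
    by auto
  finally show ?thesis .
qed

end
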